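(* Let $A$ be a Banach algebra, $B$ a Banach $A$-bimodule, $n\ge 0$ an even number, and $D:A^{(n)}\to B^{(n+1)}$ a derivation. If $\tilde{Z}^\ell_{A^{(n+2)}}(B^{(n+2)})=B^{(n+2)}$, then the second adjoint $D'':A^{(n+2)}\to B^{(n+3)}$ is a derivation.
   Context: $X^{(n)}$ denotes the $n$-th dual of $X$, $X^{(0)}=X$. For a bounded bilinear map $m:X\times Y\to Z$, define $\langle m^*(z',x),y\rangle=\langle z',m(x,y)\rangle$, $\langle m^{**}(y'',z'),x\rangle=\langle y'',m^*(z',x)\rangle$, $\langle m^{***}(x'',y''),z'\rangle=\langle x'',m^{**}(y'',z')\rangle$, so $m^{***}:X^{**}\times Y^{**}\to Z^{**}$. If $\pi_\ell:A\times B\to B$, $\pi_r:B\times A\to B$ are the module actions, then $A^{**}$ carries the first Arens product (the $^{***}$-extension of the multiplication) and $B^{**}$ is a Banach $A^{**}$-bimodule with $a''b''=\pi_\ell^{***}(a'',b'')$, $b''a''=\pi_r^{***}(b'',a'')$. Iterating, for even $n$, $A^{(n)}$ is a Banach algebra and $B^{(n)}$ a Banach $A^{(n)}$-bimodule; $B^{(n+1)}$ is its dual $A^{(n)}$-bimodule: $\langle b^{(n+1)}a^{(n)},b^{(n)}\rangle=\langle b^{(n+1)},a^{(n)}b^{(n)}\rangle$, $\langle a^{(n)}b^{(n+1)},b^{(n)}\rangle=\langle b^{(n+1)},b^{(n)}a^{(n)}\rangle$. $\tilde Z^\ell_{A^{(n+2)}}(B^{(n+2)})$ is the set of $b\in B^{(n+2)}$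 such that $a\mapsto ba$, from $A^{(n+2)}$ with $\sigma(A^{(n+2)},A^{(n+1)})$ to $B^{(n+2)}$ with its weak topology $\sigma(B^{(n+2)},B^{(n+3)})$, is continuous. A derivation from a Banach algebra $C$ into a Banach $C$-bimodule $M$ is a bounded linear map $D$ with $D(xy)=xD(y)+D(x)y$ for all $x,y\in C$. *)

theory Defs
  imports "HOL-Analysis.Analysis" "HOL-Algebra.Module"
begin

section \<open>Normed spaces on a carrier set\<close>

text \<open>
  The iterated duals of a space live at ever larger types, so a statement about the
  \<open>n\<close>-th dual for a variable \<open>n\<close> needs carrier-based spaces.  They are modules in the sense
  of HOL-Algebra, with a norm, over the scalar field \<open>'k :: real_normed_field\<close>.  By the
  Gelfand--Mazur theorem such a \<open>'k\<close> is \<open>real\<close> or \<open>complex\<close> up to isometric isomorphism,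
  so both choices of scalars are covered.
\<close>

record ('k, 'v) normed_module = "('k, 'v) module" +
  nrm :: "'v \<Rightarrow> real"

text \<open>The scalar field as a ring, and as a normed space over itself.\<close>

definition scalars :: "('k::real_normed_field, 'k) normed_module" where
  "scalars = \<lparr>carrier = UNIV, mult = (*), one = 1, zero = 0, add = (+), smult = (*), nrm = norm\<rparr>"

locale normed_space = module scalars X
  for X :: "('k::real_normed_field, 'v) normed_module" (structure) +
  assumes nrm_eq_0_iff: "x \<in> carrier X \<Longrightarrow> nrm X x = 0 \<longleftrightarrow> x = \<zero>\<^bsub>X\<^esub>"
    and nrm_triangle: "\<lbrakk>x \<in> carrier X; y \<in> carrier X\<rbrakk> \<Longrightarrow> nrm X (x \<oplus>\<^bsub>X\<^esub> y) \<le> nrm X x + nrm X y"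
    and nrm_smult: "x \<in> carrier X \<Longrightarrow> nrm X (c \<odot>\<^bsub>X\<^esub> x) = norm c * nrm X x"

text \<open>\<open>Metric_space\<close> constrains the distance function outside the carrier, too.\<close>

definition nrm_dist :: "('k::real_normed_field, 'v) normed_module \<Rightarrow> 'v \<Rightarrow> 'v \<Rightarrow> real" where
  "nrm_dist X x y = (if x \<in> carrier X \<and> y \<in> carrier X then nrm X (x \<ominus>\<^bsub>X\<^esub> y) else 0)"

locale banach_space = normed_space +
  assumes complete: "Metric_space.mcomplete (carrier X) (nrm_dist X)"

definition linear_map_on ::
  "('k::real_normed_field, 'v) normed_module \<Rightarrow> ('k, 'w) normed_module \<Rightarrow> ('v \<Rightarrow> 'w) \<Rightarrow> bool" where
  "linear_map_on X Y f \<longleftrightarrow> f \<in> carrier X \<rightarrow> carrier Y \<and>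
     (\<forall>x\<in>carrier X. \<forall>y\<in>carrier X. f (x \<oplus>\<^bsub>X\<^esub> y) = f x \<oplus>\<^bsub>Y\<^esub> f y) \<and>
     (\<forall>c. \<forall>x\<in>carrier X. f (c \<odot>\<^bsub>X\<^esub> x) = c \<odot>\<^bsub>Y\<^esub> f x)"

definition bounded_linear_map_on ::
  "('k::real_normed_field, 'v) normed_module \<Rightarrow> ('k, 'w) normed_module \<Rightarrow> ('v \<Rightarrow> 'w) \<Rightarrow> bool" where
  "bounded_linear_map_on X Y f \<longleftrightarrow> linear_map_on X Y f \<and>
     (\<exists>K. \<forall>x\<in>carrier X. nrm Y (f x) \<le> K * nrm X x)"

definition bounded_bilinear_map_on ::
  "('k::real_normed_field, 'x) normed_module \<Rightarrow> ('k, 'y) normed_module \<Rightarrow>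
   ('k, 'z) normed_module \<Rightarrow> ('x \<Rightarrow> 'y \<Rightarrow> 'z) \<Rightarrow> bool" where
  "bounded_bilinear_map_on X Y Z m \<longleftrightarrow>
     (\<forall>x\<in>carrier X. linear_map_on Y Z (m x)) \<and>
     (\<forall>y\<in>carrier Y. linear_map_on X Z (\<lambda>x. m x y)) \<and>
     (\<exists>K. \<forall>x\<in>carrier X. \<forall>y\<in>carrier Y. nrm Z (m x y) \<le> K * nrm X x * nrm Y y)"


section \<open>Banach algebras and Banach bimodules\<close>

text \<open>No unit is required; the field \<open>one\<close> of the record carries no meaning here.\<close>

locale banach_algebra = banach_space A
  for A :: "('k::real_normed_field, 'v) normed_module" (structure) +
  assumes mult_bilinear: "bounded_bilinear_map_on A A A (\<otimes>\<^bsub>A\<^esub>)"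
    and mult_assoc: "\<lbrakk>x \<in> carrier A; y \<in> carrier A; z \<in> carrier A\<rbrakk> \<Longrightarrow>
          (x \<otimes>\<^bsub>A\<^esub> y) \<otimes>\<^bsub>A\<^esub> z = x \<otimes>\<^bsub>A\<^esub> (y \<otimes>\<^bsub>A\<^esub> z)"
    and nrm_mult: "\<lbrakk>x \<in> carrier A; y \<in> carrier A\<rbrakk> \<Longrightarrow> nrm A (x \<otimes>\<^bsub>A\<^esub> y) \<le> nrm A x * nrm A y"

locale banach_bimodule = A: banach_algebra A + B: banach_space B
  for A :: "('k::real_normed_field, 'v) normed_module"
    and B :: "('k, 'w) normed_module"
    and lact :: "'v \<Rightarrow> 'w \<Rightarrow> 'w" and ract :: "'w \<Rightarrow> 'v \<Rightarrow> 'w" +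
  assumes lact_bilinear: "bounded_bilinear_map_on A B B lact"
    and ract_bilinear: "bounded_bilinear_map_on B A B ract"
    and lact_mult: "\<lbrakk>x \<in> carrier A; y \<in> carrier A; b \<in> carrier B\<rbrakk> \<Longrightarrow>
          lact (x \<otimes>\<^bsub>A\<^esub> y) b = lact x (lact y b)"
    and ract_mult: "\<lbrakk>x \<in> carrier A; y \<in> carrier A; b \<in> carrier B\<rbrakk> \<Longrightarrow>
          ract b (x \<otimes>\<^bsub>A\<^esub> y) = ract (ract b x) y"
    and lact_ract: "\<lbrakk>x \<in> carrier A; y \<in> carrier A; b \<in> carrier B\<rbrakk> \<Longrightarrow>
          ract (lact x b) y = lact x (ract b y)"


section \<open>Iterated duals\<close>

text \<open>The concrete dual: bounded linear functionals with pointwise operations and operator norm.\<close>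

definition dual_space ::
  "('k::real_normed_field, 'v) normed_module \<Rightarrow> ('k, 'v \<Rightarrow> 'k) normed_module" where
  "dual_space X = \<lparr>carrier = {f \<in> extensional (carrier X). bounded_linear_map_on X scalars f},
     mult = undefined, one = undefined,
     zero = (\<lambda>x\<in>carrier X. 0), add = (\<lambda>f g. \<lambda>x\<in>carrier X. f x + g x),
     smult = (\<lambda>c f. \<lambda>x\<in>carrier X. c * f x),
     nrm = (\<lambda>f. SUP x\<in>{x \<in> carrier X. nrm X x \<le> 1}. norm (f x))\<rparr>"

text \<open>
  \<open>is_dual X X' p\<close>: through the pairing \<open>p x' x = \<langle>x', x\<rangle>\<close>, the space \<open>X'\<close> is the dual of \<open>X\<close>,
  that is, \<open>x' \<mapsto> \<langle>x', \<cdot>\<rangle>\<close> is an isometric isomorphism of \<open>X'\<close> onto \<open>dual_space X\<close>.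
\<close>

definition is_dual ::
  "('k::real_normed_field, 'v) normed_module \<Rightarrow> ('k, 'w) normed_module \<Rightarrow>
   ('w \<Rightarrow> 'v \<Rightarrow> 'k) \<Rightarrow> bool" where
  "is_dual X X' p \<longleftrightarrow> normed_space X' \<and>
     (let J = (\<lambda>x'. \<lambda>x\<in>carrier X. p x' x) in
        linear_map_on X' (dual_space X) J \<and>
        bij_betw J (carrier X') (carrier (dual_space X)) \<and>
        (\<forall>x'\<in>carrier X'. nrm (dual_space X) (J x') = nrm X' x'))"

text \<open>
  \<open>level T i\<close> is the \<open>i\<close>-th dual \<open>X\<^sup>(\<^sup>i\<^sup>)\<close> and \<open>pair T i\<close> is the pairing of \<open>X\<^sup>(\<^sup>i\<^sup>+\<^sup>1\<^sup>)\<close> with \<open>X\<^sup>(\<^sup>i\<^sup>)\<close>.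
  All levels are carriers in one type \<open>'v\<close>, which is no restriction as long as only finitely
  many of them are required: take the disjoint sum of the types of \<open>X\<close>, \<open>dual_space X\<close>,
  \<open>dual_space (dual_space X)\<close>, and so on.  Hence \<open>iterated_duals\<close> only speaks about
  the duals up to a given order \<open>k\<close>.
\<close>

record ('k, 'v) dual_tower =
  level :: "nat \<Rightarrow> ('k, 'v) normed_module"
  pair :: "nat \<Rightarrow> 'v \<Rightarrow> 'v \<Rightarrow> 'k"

definition iterated_duals ::
  "('k::real_normed_field, 'v) normed_module \<Rightarrow> nat \<Rightarrow> ('k, 'v) dual_tower \<Rightarrow> bool" where
  "iterated_duals X k T \<longleftrightarrow> level T 0 = X \<and>
     (\<forall>i<k. is_dual (level T i) (level T (Suc i)) (pair T i))"

text \<open>The element of the \<open>(i+1)\<close>-st dual that represents the functional \<open>\<phi>\<close> on the \<open>i\<close>-th dual.\<close>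

definition functional ::
  "('k::real_normed_field, 'v) dual_tower \<Rightarrow> nat \<Rightarrow> ('v \<Rightarrow> 'k) \<Rightarrow> 'v" where
  "functional T i \<phi> = (THE x'. x' \<in> carrier (level T (Suc i)) \<and>
     (\<forall>x\<in>carrier (level T i). pair T i x' x = \<phi> x))"

text \<open>
  For \<open>D : X\<^sup>(\<^sup>i\<^sup>) \<rightarrow> Y\<^sup>(\<^sup>j\<^sup>)\<close> the adjoint \<open>D' : Y\<^sup>(\<^sup>j\<^sup>+\<^sup>1\<^sup>) \<rightarrow> X\<^sup>(\<^sup>i\<^sup>+\<^sup>1\<^sup>)\<close>,
  \<open>\<langle>D' y', x\<rangle> = \<langle>y', D x\<rangle>\<close>, and the second adjoint \<open>D'' : X\<^sup>(\<^sup>i\<^sup>+\<^sup>2\<^sup>) \<rightarrow> Y\<^sup>(\<^sup>j\<^sup>+\<^sup>2\<^sup>)\<close>.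
\<close>

definition adjoint_map ::
  "('k::real_normed_field, 'x) dual_tower \<Rightarrow> nat \<Rightarrow> ('k, 'y) dual_tower \<Rightarrow> nat \<Rightarrow>
   ('x \<Rightarrow> 'y) \<Rightarrow> 'y \<Rightarrow> 'x" where
  "adjoint_map TX i TY j D y' = functional TX i (\<lambda>x. pair TY j y' (D x))"

definition second_adjoint ::
  "('k::real_normed_field, 'x) dual_tower \<Rightarrow> nat \<Rightarrow> ('k, 'y) dual_tower \<Rightarrow> nat \<Rightarrow>
   ('x \<Rightarrow> 'y) \<Rightarrow> 'x \<Rightarrow> 'y" where
  "second_adjoint TX i TY j D = adjoint_map TY (Suc j) TX (Suc i) (adjoint_map TX i TY j D)"

text \<open>
  For \<open>m : U \<times> Y\<^sup>(\<^sup>j\<^sup>) \<rightarrow> Z\<^sup>(\<^sup>k\<^sup>)\<close> the adjoint \<open>m\<^sup>* : Z\<^sup>(\<^sup>k\<^sup>+\<^sup>1\<^sup>) \<times> U \<rightarrow> Y\<^sup>(\<^sup>j\<^sup>+\<^sup>1\<^sup>)\<close>,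
  \<open>\<langle>m\<^sup>*(z', u), y\<rangle> = \<langle>z', m(u, y)\<rangle>\<close>.
\<close>

definition bilinear_adjoint ::
  "('k::real_normed_field, 'y) dual_tower \<Rightarrow> nat \<Rightarrow> ('k, 'z) dual_tower \<Rightarrow> nat \<Rightarrow>
   ('u \<Rightarrow> 'y \<Rightarrow> 'z) \<Rightarrow> 'z \<Rightarrow> 'u \<Rightarrow> 'y" where
  "bilinear_adjoint TY j TZ k m z' u = functional TY j (\<lambda>y. pair TZ k z' (m u y))"

text \<open>
  For \<open>m : X\<^sup>(\<^sup>i\<^sup>) \<times> Y\<^sup>(\<^sup>i\<^sup>) \<rightarrow> Z\<^sup>(\<^sup>i\<^sup>)\<close> the extension
  \<open>m\<^sup>*\<^sup>*\<^sup>* : X\<^sup>(\<^sup>i\<^sup>+\<^sup>2\<^sup>) \<times> Y\<^sup>(\<^sup>i\<^sup>+\<^sup>2\<^sup>) \<rightarrow> Z\<^sup>(\<^sup>i\<^sup>+\<^sup>2\<^sup>)\<close>.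
\<close>

definition arens_extension ::
  "('k::real_normed_field, 'x) dual_tower \<Rightarrow> ('k, 'y) dual_tower \<Rightarrow> ('k, 'z) dual_tower \<Rightarrow> nat \<Rightarrow>
   ('x \<Rightarrow> 'y \<Rightarrow> 'z) \<Rightarrow> 'x \<Rightarrow> 'y \<Rightarrow> 'z" where
  "arens_extension TX TY TZ i m =
     (let m1 = bilinear_adjoint TY i TZ i m;
          m2 = bilinear_adjoint TX i TY (Suc i) m1
      in bilinear_adjoint TZ (Suc i) TX (Suc i) m2)"

text \<open>
  The extension of \<open>m : X \<times> Y \<rightarrow> Z\<close> to the \<open>n\<close>-th duals, for even \<open>n\<close>; nothing is claimed
  for odd \<open>n\<close>.
\<close>

fun iterated_extension ::
  "('k::real_normed_field, 'x) dual_tower \<Rightarrow> ('k, 'y) dual_tower \<Rightarrow> ('k, 'z) dual_tower \<Rightarrow>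
   ('x \<Rightarrow> 'y \<Rightarrow> 'z) \<Rightarrow> nat \<Rightarrow> 'x \<Rightarrow> 'y \<Rightarrow> 'z" where
  "iterated_extension TX TY TZ m 0 = m"
| "iterated_extension TX TY TZ m (Suc 0) = undefined"
| "iterated_extension TX TY TZ m (Suc (Suc n)) =
     arens_extension TX TY TZ n (iterated_extension TX TY TZ m n)"

text \<open>The product of \<open>A\<^sup>(\<^sup>n\<^sup>)\<close> and the actions of \<open>A\<^sup>(\<^sup>n\<^sup>)\<close> on \<open>B\<^sup>(\<^sup>n\<^sup>)\<close>, for even \<open>n\<close>.\<close>

definition even_mult ::
  "('k::real_normed_field, 'v) dual_tower \<Rightarrow> nat \<Rightarrow> 'v \<Rightarrow> 'v \<Rightarrow> 'v" where
  "even_mult TA n = iterated_extension TA TA TA (mult (level TA 0)) n"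

definition even_lact ::
  "('k::real_normed_field, 'v) dual_tower \<Rightarrow> ('k, 'w) dual_tower \<Rightarrow>
   ('v \<Rightarrow> 'w \<Rightarrow> 'w) \<Rightarrow> nat \<Rightarrow> 'v \<Rightarrow> 'w \<Rightarrow> 'w" where
  "even_lact TA TB lact n = iterated_extension TA TB TB lact n"

definition even_ract ::
  "('k::real_normed_field, 'v) dual_tower \<Rightarrow> ('k, 'w) dual_tower \<Rightarrow>
   ('w \<Rightarrow> 'v \<Rightarrow> 'w) \<Rightarrow> nat \<Rightarrow> 'w \<Rightarrow> 'v \<Rightarrow> 'w" where
  "even_ract TA TB ract n = iterated_extension TB TA TB ract n"

text \<open>The dual actions of \<open>A\<^sup>(\<^sup>n\<^sup>)\<close> on \<open>B\<^sup>(\<^sup>n\<^sup>+\<^sup>1\<^sup>)\<close>, for even \<open>n\<close>: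
  \<open>\<langle>a b', b\<rangle> = \<langle>b', b a\<rangle>\<close> and \<open>\<langle>b' a, b\<rangle> = \<langle>b', a b\<rangle>\<close>.\<close>

definition dual_lact ::
  "('k::real_normed_field, 'v) dual_tower \<Rightarrow> ('k, 'w) dual_tower \<Rightarrow>
   ('w \<Rightarrow> 'v \<Rightarrow> 'w) \<Rightarrow> nat \<Rightarrow> 'v \<Rightarrow> 'w \<Rightarrow> 'w" where
  "dual_lact TA TB ract n a b' = functional TB n (\<lambda>b. pair TB n b' (even_ract TA TB ract n b a))"

definition dual_ract ::
  "('k::real_normed_field, 'v) dual_tower \<Rightarrow> ('k, 'w) dual_tower \<Rightarrow>
   ('v \<Rightarrow> 'w \<Rightarrow> 'w) \<Rightarrow> nat \<Rightarrow> 'w \<Rightarrow> 'v \<Rightarrow> 'w" where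
  "dual_ract TA TB lact n b' a = functional TB n (\<lambda>b. pair TB n b' (even_lact TA TB lact n a b))"


section \<open>Derivations, weak topologies and the topological centre\<close>

definition derivation ::
  "('k::real_normed_field, 'v) normed_module \<Rightarrow> ('v \<Rightarrow> 'v \<Rightarrow> 'v) \<Rightarrow> ('k, 'w) normed_module \<Rightarrow>
   ('v \<Rightarrow> 'w \<Rightarrow> 'w) \<Rightarrow> ('w \<Rightarrow> 'v \<Rightarrow> 'w) \<Rightarrow> ('v \<Rightarrow> 'w) \<Rightarrow> bool" where
  "derivation C mul M lact ract D \<longleftrightarrow> bounded_linear_map_on C M D \<and>
     (\<forall>x\<in>carrier C. \<forall>y\<in>carrier C. D (mul x y) = lact x (D y) \<oplus>\<^bsub>M\<^esub> ract (D x) y)"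

text \<open>\<open>initial_topology S F\<close> is the coarsest topology on \<open>S\<close> that makes all \<open>\<phi> \<in> F\<close> continuous;
  \<open>S\<close> itself is added to the subbasis only to cover \<open>F = {}\<close>.\<close>

definition initial_topology :: "'v set \<Rightarrow> ('v \<Rightarrow> 'k::topological_space) set \<Rightarrow> 'v topology" where
  "initial_topology S F =
     topology_generated_by (insert S {{x \<in> S. \<phi> x \<in> U} |\<phi> U. \<phi> \<in> F \<and> open U})"

text \<open>\<open>weak_top T i\<close> is \<open>\<sigma>(X\<^sup>(\<^sup>i\<^sup>), X\<^sup>(\<^sup>i\<^sup>+\<^sup>1\<^sup>))\<close> and \<open>weak_star_top T i\<close> is \<open>\<sigma>(X\<^sup>(\<^sup>i\<^sup>+\<^sup>1\<^sup>), X\<^sup>(\<^sup>i\<^sup>))\<close>.\<close>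

definition weak_top :: "('k::real_normed_field, 'v) dual_tower \<Rightarrow> nat \<Rightarrow> 'v topology" where
  "weak_top T i = initial_topology (carrier (level T i))
     ((\<lambda>x' x. pair T i x' x) ` carrier (level T (Suc i)))"

definition weak_star_top :: "('k::real_normed_field, 'v) dual_tower \<Rightarrow> nat \<Rightarrow> 'v topology" where
  "weak_star_top T i = initial_topology (carrier (level T (Suc i)))
     ((\<lambda>x x'. pair T i x' x) ` carrier (level T i))"

text \<open>For even \<open>n\<close>, the left centre: the set of those \<open>b \<in> B\<^sup>(\<^sup>n\<^sup>+\<^sup>2\<^sup>)\<close> for which \<open>a \<mapsto> b a\<close> is weak-star to
  weak continuous from \<open>A\<^sup>(\<^sup>n\<^sup>+\<^sup>2\<^sup>)\<close> to \<open>B\<^sup>(\<^sup>n\<^sup>+\<^sup>2\<^sup>)\<close>.\<close>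

definition left_weak_centre ::
  "('k::real_normed_field, 'v) dual_tower \<Rightarrow> ('k, 'w) dual_tower \<Rightarrow>
   ('w \<Rightarrow> 'v \<Rightarrow> 'w) \<Rightarrow> nat \<Rightarrow> 'w set" where
  "left_weak_centre TA TB ract n = {b \<in> carrier (level TB (n + 2)).
     continuous_map (weak_star_top TA (n + 1)) (weak_top TB (n + 2))
       (\<lambda>a. even_ract TA TB ract (n + 2) b a)}"

end

theory Submission
  imports Defs
begin

text \<open>
  Write \<open>s, t\<close> for elements of \<open>A\<^sup>(\<^sup>n\<^sup>+\<^sup>2\<^sup>)\<close> and test the Leibniz rule for \<open>D''\<close> against
  \<open>b \<in> B\<^sup>(\<^sup>n\<^sup>+\<^sup>2\<^sup>)\<close>.  By the definition of the Arens product, \<open>\<langle>D''(s t), b\<rangle>\<close> arises from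
  \<open>\<langle>b, D(x y)\<rangle> = \<langle>b, x D(y)\<rangle> + \<langle>b, D(x) y\<rangle>\<close> by applying first \<open>t\<close> in the variable \<open>y\<close> and then
  \<open>s\<close> in the variable \<open>x\<close>.  The extended left action uses the same order, so the second summand
  turns into \<open>\<langle>D''(s) t, b\<rangle>\<close> by definition alone.

  The first summand is the delicate one.  For \<open>x\<close> in \<open>A\<^sup>(\<^sup>n\<^sup>)\<close>, with canonical image \<open>j\<close> in \<open>A\<^sup>(\<^sup>n\<^sup>+\<^sup>2\<^sup>)\<close>,
  applying \<open>t\<close> gives \<open>\<langle>D''(t), b j\<rangle>\<close>; applying \<open>s\<close> must give \<open>\<langle>D''(t), b s\<rangle>\<close>.  This is a matter of
  continuity of \<open>F(a) = \<langle>D''(t), b a\<rangle>\<close>, and the hypothesis on the centre ensures that \<open>F\<close> is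
  weak-star continuous, as \<open>D''(t)\<close> is one of the functionals that define the weak topology of
  \<open>B\<^sup>(\<^sup>n\<^sup>+\<^sup>2\<^sup>)\<close>.  Therefore
  \<open>F\<close> is evaluation at some \<open>f \<in> A\<^sup>(\<^sup>n\<^sup>+\<^sup>1\<^sup>)\<close> (lemma \<open>weak_star_continuous_is_eval\<close>), the
  values \<open>F(j)\<close> identify \<open>f\<close> as the functional to which \<open>s\<close> is applied in the first summand, and
  hence the result is \<open>F(s)\<close>.

  The duals are given through pairings and the adjoints through descriptions of the
  representing elements, so all identities are checked by pairing (lemma \<open>dual_eqI\<close>), and
  \<open>bilinear_adjoint_pair\<close>, \<open>arens_extension_pair\<close> and \<open>adjoint_map_pair\<close> evaluate these
  descriptions as long as the maps involved are bounded.
\<close>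

section \<open>Linear maps on carriers\<close>

lemma linear_map_on_scalars_iff:
  "linear_map_on X scalars f \<longleftrightarrow>
     (\<forall>x\<in>carrier X. \<forall>y\<in>carrier X. f (x \<oplus>\<^bsub>X\<^esub> y) = f x + f y) \<and>
     (\<forall>c. \<forall>x\<in>carrier X. f (c \<odot>\<^bsub>X\<^esub> x) = c * f x)"
  by (auto simp: linear_map_on_def scalars_def)

lemma bounded_linear_map_on_scalars_iff:
  "bounded_linear_map_on X scalars f \<longleftrightarrow>
     (\<forall>x\<in>carrier X. \<forall>y\<in>carrier X. f (x \<oplus>\<^bsub>X\<^esub> y) = f x + f y) \<and>
     (\<forall>c. \<forall>x\<in>carrier X. f (c \<odot>\<^bsub>X\<^esub> x) = c * f x) \<and>
     (\<exists>K. \<forall>x\<in>carrier X. norm (f x) \<le> K * nrm X x)"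
  unfolding bounded_linear_map_on_def linear_map_on_scalars_iff by (auto simp: scalars_def)

lemma bounded_bilinear_map_on_iff:
  "bounded_bilinear_map_on X Y Z m \<longleftrightarrow>
     (\<forall>x\<in>carrier X. \<forall>y\<in>carrier Y. m x y \<in> carrier Z) \<and>
     (\<forall>x\<in>carrier X. \<forall>y\<in>carrier Y. \<forall>y2\<in>carrier Y. m x (y \<oplus>\<^bsub>Y\<^esub> y2) = m x y \<oplus>\<^bsub>Z\<^esub> m x y2) \<and>
     (\<forall>c. \<forall>x\<in>carrier X. \<forall>y\<in>carrier Y. m x (c \<odot>\<^bsub>Y\<^esub> y) = c \<odot>\<^bsub>Z\<^esub> m x y) \<and>
     (\<forall>x\<in>carrier X. \<forall>x2\<in>carrier X. \<forall>y\<in>carrier Y. m (x \<oplus>\<^bsub>X\<^esub> x2) y = m x y \<oplus>\<^bsub>Z\<^esub> m x2 y) \<and>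
     (\<forall>c. \<forall>x\<in>carrier X. \<forall>y\<in>carrier Y. m (c \<odot>\<^bsub>X\<^esub> x) y = c \<odot>\<^bsub>Z\<^esub> m x y) \<and>
     (\<exists>K. \<forall>x\<in>carrier X. \<forall>y\<in>carrier Y. nrm Z (m x y) \<le> K * nrm X x * nrm Y y)"
  unfolding bounded_bilinear_map_on_def linear_map_on_def by (auto simp: Pi_iff)

lemma bounded_bilinear_map_on_flip:
  assumes "bounded_bilinear_map_on X Y Z m"
  shows "bounded_bilinear_map_on Y X Z (\<lambda>y x. m x y)"
proof -
  obtain K where "\<forall>x\<in>carrier X. \<forall>y\<in>carrier Y. nrm Z (m x y) \<le> K * nrm X x * nrm Y y"
    using assms unfolding bounded_bilinear_map_on_def by blast
  then have "\<forall>y\<in>carrier Y. \<forall>x\<in>carrier X. nrm Z (m x y) \<le> K * nrm Y y * nrm X x"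
    by (simp add: mult.assoc mult.commute[of "nrm X _"])
  with assms show ?thesis
    unfolding bounded_bilinear_map_on_def by blast
qed

context normed_space
begin

lemma add_closed: "x \<in> carrier X \<Longrightarrow> y \<in> carrier X \<Longrightarrow> x \<oplus>\<^bsub>X\<^esub> y \<in> carrier X"
  by simp

lemma scale_closed: "x \<in> carrier X \<Longrightarrow> c \<odot>\<^bsub>X\<^esub> x \<in> carrier X"
  using smult_closed[of c x] by (simp add: scalars_def)

lemma zero_mem: "\<zero>\<^bsub>X\<^esub> \<in> carrier X"
  by simp

lemma nrm_zero: "nrm X \<zero>\<^bsub>X\<^esub> = 0"
  by (simp add: nrm_eq_0_iff)

lemma nrm_nonneg:
  assumes "x \<in> carrier X"
  shows "0 \<le> nrm X x"
proof -
  have "((1::'k) + -1) \<odot>\<^bsub>X\<^esub> x = 1 \<odot>\<^bsub>X\<^esub> x \<oplus>\<^bsub>X\<^esub> (-1) \<odot>\<^bsub>X\<^esub> x"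
    using smult_l_distr[of 1 "-1" x] assms by (simp add: scalars_def)
  then have "nrm X ((0::'k) \<odot>\<^bsub>X\<^esub> x) \<le> nrm X ((1::'k) \<odot>\<^bsub>X\<^esub> x) + nrm X ((-1::'k) \<odot>\<^bsub>X\<^esub> x)"
    using nrm_triangle[of "(1::'k) \<odot>\<^bsub>X\<^esub> x" "(-1::'k) \<odot>\<^bsub>X\<^esub> x"] assms by (simp add: scale_closed)
  then show ?thesis
    using assms by (simp add: nrm_smult)
qed

lemma linear_functional_zero:
  assumes "linear_map_on X scalars f"
  shows "f \<zero>\<^bsub>X\<^esub> = 0"
proof -
  have "f (\<zero>\<^bsub>X\<^esub> \<oplus>\<^bsub>X\<^esub> \<zero>\<^bsub>X\<^esub>) = f \<zero>\<^bsub>X\<^esub> + f \<zero>\<^bsub>X\<^esub>"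
    using assms zero_mem unfolding linear_map_on_scalars_iff by blast
  then show ?thesis
    by simp
qed

lemma nonneg_bound:
  assumes "bounded_linear_map_on X Y f"
  obtains K where "K \<ge> 0" "\<And>x. x \<in> carrier X \<Longrightarrow> nrm Y (f x) \<le> K * nrm X x"
proof -
  obtain K where K: "\<And>x. x \<in> carrier X \<Longrightarrow> nrm Y (f x) \<le> K * nrm X x"
    using assms unfolding bounded_linear_map_on_def by blast
  show thesis
  proof (rule that[of "max K 0"])
    fix x assume x: "x \<in> carrier X"
    have "K * nrm X x \<le> max K 0 * nrm X x"
      by (intro mult_right_mono) (use nrm_nonneg[OF x] in auto)
    with K[OF x] show "nrm Y (f x) \<le> max K 0 * nrm X x"
      by linarith
  qed simp
qed

end

lemma bilinear_nonneg_bound: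
  assumes "bounded_bilinear_map_on X Y Z m" "normed_space X" "normed_space Y"
  obtains K where "K \<ge> 0"
    "\<And>x y. x \<in> carrier X \<Longrightarrow> y \<in> carrier Y \<Longrightarrow> nrm Z (m x y) \<le> K * nrm X x * nrm Y y"
proof -
  obtain K where K: "\<And>x y. x \<in> carrier X \<Longrightarrow> y \<in> carrier Y \<Longrightarrow> nrm Z (m x y) \<le> K * nrm X x * nrm Y y"
    using assms(1) unfolding bounded_bilinear_map_on_def by blast
  show thesis
  proof (rule that[of "max K 0"])
    fix x y assume xy: "x \<in> carrier X" "y \<in> carrier Y"
    have "K * nrm X x * nrm Y y \<le> max K 0 * nrm X x * nrm Y y"
      by (intro mult_right_mono)
        (use normed_space.nrm_nonneg[OF assms(2) xy(1)] normed_space.nrm_nonneg[OF assms(3) xy(2)] in auto)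
    with K[OF xy] show "nrm Z (m x y) \<le> max K 0 * nrm X x * nrm Y y"
      by linarith
  qed simp
qed


section \<open>The pairing of a space with its dual\<close>

locale dual_step =
  fixes T :: "('k::real_normed_field, 'v) dual_tower" and i :: nat
  assumes normed: "normed_space (level T i)"
    and dual: "is_dual (level T i) (level T (Suc i)) (pair T i)"
begin

abbreviation V where "V \<equiv> level T i"
abbreviation V' where "V' \<equiv> level T (Suc i)"

lemma normed_dual: "normed_space V'"
  using dual by (simp add: is_dual_def)

lemma restricted_pair_mem:
  assumes "x' \<in> carrier V'"
  shows "(\<lambda>x\<in>carrier V. pair T i x' x) \<in> carrier (dual_space V)"
  using dual assms unfolding is_dual_def Let_def bij_betw_def by auto

lemma pair_bounded_linear:
  assumes "x' \<in> carrier V'"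
  shows "bounded_linear_map_on V scalars (pair T i x')"
  using restricted_pair_mem[OF assms] normed_space.add_closed[OF normed] normed_space.scale_closed[OF normed]
  unfolding dual_space_def bounded_linear_map_on_scalars_iff
  by (simp add: bounded_linear_map_on_scalars_iff)

lemma pair_linear: "x' \<in> carrier V' \<Longrightarrow> linear_map_on V scalars (pair T i x')"
  using pair_bounded_linear by (simp add: bounded_linear_map_on_def)

lemma pair_add:
  "x' \<in> carrier V' \<Longrightarrow> x \<in> carrier V \<Longrightarrow> y \<in> carrier V \<Longrightarrow>
     pair T i x' (x \<oplus>\<^bsub>V\<^esub> y) = pair T i x' x + pair T i x' y"
  and pair_smult:
  "x' \<in> carrier V' \<Longrightarrow> x \<in> carrier V \<Longrightarrow> pair T i x' (c \<odot>\<^bsub>V\<^esub> x) = c * pair T i x' x"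
  using pair_linear by (auto simp: linear_map_on_scalars_iff)

lemma pair_zero: "x' \<in> carrier V' \<Longrightarrow> pair T i x' \<zero>\<^bsub>V\<^esub> = 0"
  using pair_linear normed_space.linear_functional_zero[OF normed] by blast

lemma pair_add_left:
  assumes "x' \<in> carrier V'" "y' \<in> carrier V'" "x \<in> carrier V"
  shows "pair T i (x' \<oplus>\<^bsub>V'\<^esub> y') x = pair T i x' x + pair T i y' x"
proof -
  have "(\<lambda>x\<in>carrier V. pair T i (x' \<oplus>\<^bsub>V'\<^esub> y') x) =
      (\<lambda>x\<in>carrier V. pair T i x' x) \<oplus>\<^bsub>dual_space V\<^esub> (\<lambda>x\<in>carrier V. pair T i y' x)"
    using dual assms unfolding is_dual_def Let_def linear_map_on_def by blast
  from fun_cong[OF this, of x] show ?thesis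
    using assms by (simp add: dual_space_def)
qed

lemma pair_smult_left:
  assumes "x' \<in> carrier V'" "x \<in> carrier V"
  shows "pair T i (c \<odot>\<^bsub>V'\<^esub> x') x = c * pair T i x' x"
proof -
  have "(\<lambda>x\<in>carrier V. pair T i (c \<odot>\<^bsub>V'\<^esub> x') x) =
      c \<odot>\<^bsub>dual_space V\<^esub> (\<lambda>x\<in>carrier V. pair T i x' x)"
    using dual assms unfolding is_dual_def Let_def linear_map_on_def by blast
  from fun_cong[OF this, of x] show ?thesis
    using assms by (simp add: dual_space_def)
qed

lemma eval_linear: "x \<in> carrier V \<Longrightarrow> linear_map_on V' scalars (\<lambda>x'. pair T i x' x)"
  by (simp add: linear_map_on_scalars_iff pair_add_left pair_smult_left)

lemma dual_eqI:
  assumes "x' \<in> carrier V'" "y' \<in> carrier V'"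
    and "\<And>x. x \<in> carrier V \<Longrightarrow> pair T i x' x = pair T i y' x"
  shows "x' = y'"
proof -
  have "(\<lambda>x\<in>carrier V. pair T i x' x) = (\<lambda>x\<in>carrier V. pair T i y' x)"
    using assms(3) by auto
  then show ?thesis
    using dual assms(1,2) unfolding is_dual_def Let_def bij_betw_def inj_on_def by blast
qed

lemma nrm_dual:
  assumes "x' \<in> carrier V'"
  shows "nrm V' x' = (SUP x\<in>{x \<in> carrier V. nrm V x \<le> 1}. norm (pair T i x' x))"
proof -
  have "nrm V' x' = nrm (dual_space V) (\<lambda>x\<in>carrier V. pair T i x' x)"
    using dual assms unfolding is_dual_def Let_def by auto
  also have "\<dots> = (SUP x\<in>{x \<in> carrier V. nrm V x \<le> 1}. norm (pair T i x' x))"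
    by (auto simp: dual_space_def intro!: SUP_cong)
  finally show ?thesis .
qed

text \<open>The operator norm is a supremum over the unit ball; boundedness of the functional keeps it
  from being a default value, and rescaling by a real scalar reaches every vector.\<close>

lemma norm_pair_le:
  assumes x': "x' \<in> carrier V'" and x: "x \<in> carrier V"
  shows "norm (pair T i x' x) \<le> nrm V' x' * nrm V x"
proof -
  obtain K where K: "K \<ge> 0" "\<And>x. x \<in> carrier V \<Longrightarrow> norm (pair T i x' x) \<le> K * nrm V x"
    using normed_space.nonneg_bound[OF normed pair_bounded_linear[OF x']] by (auto simp: scalars_def)
  have bdd: "bdd_above ((\<lambda>x. norm (pair T i x' x)) ` {x \<in> carrier V. nrm V x \<le> 1})"
  proof (rule bdd_aboveI2[of _ _ K])
    fix y assume "y \<in> {x \<in> carrier V. nrm V x \<le> 1}"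
    then show "norm (pair T i x' y) \<le> K"
      using K(2)[of y] mult_left_mono[of "nrm V y" 1 K] K(1) by auto
  qed
  define r where "r = nrm V x"
  have r: "r \<ge> 0"
    using normed_space.nrm_nonneg[OF normed x] by (simp add: r_def)
  show ?thesis
  proof (cases "r = 0")
    case True
    then show ?thesis
      using K(2)[OF x] by (simp add: r_def)
  next
    case False
    define y where "y = of_real (inverse r) \<odot>\<^bsub>V\<^esub> x"
    have y: "y \<in> carrier V"
      using normed_space.scale_closed[OF normed x] by (simp add: y_def)
    have "nrm V y = 1"
      using r False normed_space.nrm_smult[OF normed x] by (simp add: y_def r_def norm_inverse)
    with y have "norm (pair T i x' y) \<le> nrm V' x'"
      unfolding nrm_dual[OF x'] by (intro cSUP_upper[OF _ bdd]) simp
    moreover have "norm (pair T i x' y) = norm (pair T i x' x) / r"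
      using r unfolding y_def by (simp add: pair_smult[OF x' x] norm_mult norm_inverse divide_inverse)
    ultimately show ?thesis
      using r False by (simp add: r_def[symmetric] divide_le_eq)
  qed
qed

text \<open>The description operator in \<^const>\<open>functional\<close> denotes: a functional on the space is
  represented exactly once.\<close>

lemma functional_correct:
  assumes "bounded_linear_map_on V scalars f"
  shows "functional T i f \<in> carrier V'" (is ?mem)
    and "x \<in> carrier V \<Longrightarrow> pair T i (functional T i f) x = f x"
proof -
  have "restrict f (carrier V) \<in> carrier (dual_space V)"
    using assms normed_space.add_closed[OF normed] normed_space.scale_closed[OF normed]
    by (simp add: dual_space_def bounded_linear_map_on_scalars_iff)
  then obtain x' where x': "x' \<in> carrier V'"
      "(\<lambda>x\<in>carrier V. pair T i x' x) = restrict f (carrier V)"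
    using dual unfolding is_dual_def Let_def bij_betw_def by (metis (no_types, lifting) imageE)
  have "\<And>x. x \<in> carrier V \<Longrightarrow> pair T i x' x = f x"
    using fun_cong[OF x'(2)] by (metis restrict_apply')
  with x'(1) have "\<exists>!x'. x' \<in> carrier V' \<and> (\<forall>x\<in>carrier V. pair T i x' x = f x)"
    using dual_eqI by (intro ex_ex1I) (blast, metis)
  from theI'[OF this]
  have *: "functional T i f \<in> carrier V' \<and> (\<forall>x\<in>carrier V. pair T i (functional T i f) x = f x)"
    unfolding functional_def .
  then show ?mem and "x \<in> carrier V \<Longrightarrow> pair T i (functional T i f) x = f x"
    by auto
qed

lemma nrm_dual_le:
  assumes "x' \<in> carrier V'" "K \<ge> 0" "\<And>x. x \<in> carrier V \<Longrightarrow> norm (pair T i x' x) \<le> K * nrm V x"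
  shows "nrm V' x' \<le> K"
  unfolding nrm_dual[OF assms(1)]
proof (rule cSUP_least)
  have "\<zero>\<^bsub>V\<^esub> \<in> {x \<in> carrier V. nrm V x \<le> 1}"
    using normed_space.zero_mem[OF normed] normed_space.nrm_zero[OF normed] by simp
  then show "{x \<in> carrier V. nrm V x \<le> 1} \<noteq> {}"
    by blast
  fix y assume "y \<in> {x \<in> carrier V. nrm V x \<le> 1}"
  then show "norm (pair T i x' y) \<le> K"
    using assms(3)[of y] mult_left_mono[of "nrm V y" 1 K] assms(2) by auto
qed

text \<open>This makes every element of the space a point of the bidual, by evaluation.\<close>

lemma eval_bounded_linear:
  assumes "x \<in> carrier V"
  shows "bounded_linear_map_on V' scalars (\<lambda>x'. pair T i x' x)"
  using eval_linear[OF assms] norm_pair_le assms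
  unfolding bounded_linear_map_on_def
  by (auto simp: scalars_def mult.commute intro!: exI[of _ "nrm V x"])


subsection \<open>Weak-star continuous functionals\<close>

text \<open>Instead of an estimate on a basic neighbourhood it suffices to keep the common kernel of the
  finitely many evaluations that enter: it passes through basic sets for trivial reasons and still
  determines weak-star continuous functionals.\<close>

lemma weak_star_nhd_contains_annihilator:
  assumes "openin (weak_star_top T i) U" "\<zero>\<^bsub>V'\<^esub> \<in> U"
  shows "\<exists>F\<subseteq>carrier V. finite F \<and> {x' \<in> carrier V'. \<forall>x\<in>F. pair T i x' x = 0} \<subseteq> U"
proof -
  have "generate_topology_on (insert (carrier V') {{x' \<in> carrier V'. f x' \<in> W} | f W.
        f \<in> (\<lambda>x x'. pair T i x' x) ` carrier V \<and> open W}) U"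
    using assms(1)
    by (simp add: weak_star_top_def initial_topology_def openin_topology_generated_by_iff)
  then show ?thesis
    using assms(2)
  proof (induction rule: generate_topology_on.induct)
    case Empty
    then show ?case by simp
  next
    case (Int a b)
    then have "\<zero>\<^bsub>V'\<^esub> \<in> a" "\<zero>\<^bsub>V'\<^esub> \<in> b"
      by auto
    from Int.IH(1)[OF this(1)] Int.IH(2)[OF this(2)] obtain F G
      where F: "F \<subseteq> carrier V" "finite F" "{x' \<in> carrier V'. \<forall>x\<in>F. pair T i x' x = 0} \<subseteq> a"
      and G: "G \<subseteq> carrier V" "finite G" "{x' \<in> carrier V'. \<forall>x\<in>G. pair T i x' x = 0} \<subseteq> b"
      by (elim exE conjE)
    have "{x' \<in> carrier V'. \<forall>x\<in>F \<union> G. pair T i x' x = 0} \<subseteq> a \<inter> b"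
      using F(3) G(3) by auto
    then show ?case
      using F(1,2) G(1,2) by (intro exI[of _ "F \<union> G"]) simp
  next
    case (UN K)
    then obtain k where k: "k \<in> K" "\<zero>\<^bsub>V'\<^esub> \<in> k"
      by (elim UnionE)
    from UN.IH[OF this] obtain F where F: "F \<subseteq> carrier V" "finite F"
      "{x' \<in> carrier V'. \<forall>x\<in>F. pair T i x' x = 0} \<subseteq> k"
      by (elim exE conjE)
    from F(3) k(1) have "{x' \<in> carrier V'. \<forall>x\<in>F. pair T i x' x = 0} \<subseteq> \<Union>K"
      by (meson Union_upper order_trans)
    with F(1,2) show ?case
      by (intro exI[of _ F]) simp
  next
    case (Basis s)
    show ?case
    proof (cases "s = carrier V'")
      case True
      then show ?thesis by (intro exI[of _ "{}"]) simp
    next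
      case False
      with Basis obtain x W where s: "x \<in> carrier V" "s = {x' \<in> carrier V'. pair T i x' x \<in> W}"
        by auto
      have "pair T i \<zero>\<^bsub>V'\<^esub> x = 0"
        using normed_space.linear_functional_zero[OF normed_dual eval_linear[OF s(1)]] .
      with Basis(2) s(2) have "{x' \<in> carrier V'. \<forall>y\<in>{x}. pair T i x' y = 0} \<subseteq> s"
        by auto
      with s(1) show ?thesis
        by (intro exI[of _ "{x}"]) simp
    qed
  qed
qed

lemma eval_representable_if_vanishes_on_annihilator:
  assumes "finite F" "F \<subseteq> carrier V" "linear_map_on V' scalars f"
    and "\<And>x'. x' \<in> carrier V' \<Longrightarrow> \<forall>x\<in>F. pair T i x' x = 0 \<Longrightarrow> f x' = 0"
  shows "\<exists>x\<in>carrier V. \<forall>x'\<in>carrier V'. f x' = pair T i x' x"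
  using assms
proof (induction F arbitrary: f rule: finite_induct)
  case empty
  then show ?case
    using normed_space.zero_mem[OF normed] by (intro bexI[of _ "\<zero>\<^bsub>V\<^esub>"]) (auto simp: pair_zero)
next
  case (insert z F)
  have z: "z \<in> carrier V" and F: "F \<subseteq> carrier V"
    using insert.prems(1) by auto
  have f_add: "\<And>x' y'. x' \<in> carrier V' \<Longrightarrow> y' \<in> carrier V' \<Longrightarrow> f (x' \<oplus>\<^bsub>V'\<^esub> y') = f x' + f y'"
    and f_smult: "\<And>c x'. x' \<in> carrier V' \<Longrightarrow> f (c \<odot>\<^bsub>V'\<^esub> x') = c * f x'"
    using insert.prems(2) by (auto simp: linear_map_on_scalars_iff)
  note closed = normed_space.add_closed[OF normed_dual] normed_space.scale_closed[OF normed_dual]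
  show ?case
  proof (cases "\<exists>v\<in>carrier V'. (\<forall>x\<in>F. pair T i v x = 0) \<and> pair T i v z \<noteq> 0")
    case False
    then show ?thesis
      using insert.IH[OF F insert.prems(2)] insert.prems(3) by blast
  next
    case True
    then obtain v where v: "v \<in> carrier V'" "\<forall>x\<in>F. pair T i v x = 0" "pair T i v z \<noteq> 0"
      by blast
    define q where "q = f v / pair T i v z"
    \<comment> \<open>Subtracting the right multiple of the evaluation at \<open>z\<close> kills the direction \<open>v\<close>, so the
      remainder vanishes on the annihilator of \<open>F\<close> alone.\<close>
    define g where "g x' = f x' - q * pair T i x' z" for x'
    have "linear_map_on V' scalars g"
      unfolding linear_map_on_scalars_iff g_def
      by (auto simp: f_add f_smult pair_add_left pair_smult_left z algebra_simps)
    moreover have "g x' = 0" if x': "x' \<in> carrier V'" and kill: "\<forall>x\<in>F. pair T i x' x = 0" for x'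
    proof -
      define c where "c = - (pair T i x' z / pair T i v z)"
      let ?y = "x' \<oplus>\<^bsub>V'\<^esub> c \<odot>\<^bsub>V'\<^esub> v"
      have y: "?y \<in> carrier V'"
        using x' v(1) closed by blast
      have pair_y: "pair T i ?y x = pair T i x' x + c * pair T i v x" if "x \<in> carrier V" for x
        using x' v(1) that closed by (simp add: pair_add_left pair_smult_left)
      have "pair T i ?y z = 0"
        unfolding pair_y[OF z] using v(3) by (simp add: c_def)
      moreover have "\<forall>x\<in>F. pair T i ?y x = 0"
        using F kill v(2) by (auto simp: pair_y subset_iff)
      ultimately have "f ?y = 0"
        using insert.prems(3)[OF y] by blast
      moreover have "f ?y = f x' + c * f v"
        using x' v(1) closed by (simp add: f_add f_smult)
      ultimately show ?thesis
        by (simp add: g_def q_def c_def)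
    qed
    ultimately obtain x where x: "x \<in> carrier V" "\<And>x'. x' \<in> carrier V' \<Longrightarrow> g x' = pair T i x' x"
      using insert.IH[OF F] by blast
    have "f x' = pair T i x' (x \<oplus>\<^bsub>V\<^esub> q \<odot>\<^bsub>V\<^esub> z)" if "x' \<in> carrier V'" for x'
      using x(2)[OF that] that x(1) z normed_space.scale_closed[OF normed z]
      by (simp add: g_def pair_add pair_smult algebra_simps)
    moreover have "x \<oplus>\<^bsub>V\<^esub> q \<odot>\<^bsub>V\<^esub> z \<in> carrier V"
      using x(1) z normed_space.add_closed[OF normed] normed_space.scale_closed[OF normed] by blast
    ultimately show ?thesis
      by blast
  qed
qed

text \<open>The weak-star continuous functionals on a dual space are the evaluations.  A functional that is
  bounded by \<open>1\<close> on a linear subspace vanishes there, and an open neighbourhood of \<open>0\<close> contains a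
  common kernel of finitely many evaluations.\<close>

lemma weak_star_continuous_is_eval:
  assumes lin: "linear_map_on V' scalars f"
    and op: "openin (weak_star_top T i) {x' \<in> carrier V'. norm (f x') < 1}"
  shows "\<exists>x\<in>carrier V. \<forall>x'\<in>carrier V'. f x' = pair T i x' x"
proof -
  have "\<zero>\<^bsub>V'\<^esub> \<in> {x' \<in> carrier V'. norm (f x') < 1}"
    using normed_space.zero_mem[OF normed_dual] normed_space.linear_functional_zero[OF normed_dual lin]
    by simp
  from weak_star_nhd_contains_annihilator[OF op this]
  obtain F where F: "F \<subseteq> carrier V" "finite F"
    and sub: "{x' \<in> carrier V'. \<forall>x\<in>F. pair T i x' x = 0} \<subseteq> {x' \<in> carrier V'. norm (f x') < 1}"
    by blast
  show ?thesis
  proof (rule eval_representable_if_vanishes_on_annihilator[OF F(2,1) lin])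
    fix x' assume x': "x' \<in> carrier V'" and kill: "\<forall>x\<in>F. pair T i x' x = 0"
    show "f x' = 0"
    proof (rule ccontr)
      assume "f x' \<noteq> 0"
      let ?y = "inverse (f x') \<odot>\<^bsub>V'\<^esub> x'"
      have "?y \<in> carrier V'"
        using normed_space.scale_closed[OF normed_dual x'] .
      moreover have "\<forall>x\<in>F. pair T i ?y x = 0"
        using F(1) kill by (auto simp: pair_smult_left[OF x'] subset_iff)
      ultimately have "norm (f ?y) < 1"
        using sub by blast
      moreover have "f ?y = 1"
        using lin x' \<open>f x' \<noteq> 0\<close> by (simp add: linear_map_on_scalars_iff)
      ultimately show False
        by simp
    qed
  qed
qed

end

lemma dual_step_iterated:
  assumes "iterated_duals X k T" "normed_space X" "i < k"
  shows "dual_step T i"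
proof (rule dual_step.intro)
  show "is_dual (level T i) (level T (Suc i)) (pair T i)"
    using assms by (simp add: iterated_duals_def)
  show "normed_space (level T i)"
  proof (cases i)
    case 0
    then show ?thesis using assms by (simp add: iterated_duals_def)
  next
    case (Suc j)
    then have "is_dual (level T j) (level T (Suc j)) (pair T j)"
      using assms by (simp add: iterated_duals_def)
    then show ?thesis by (simp add: is_dual_def Suc)
  qed
qed


section \<open>Adjoints and Arens extensions\<close>

lemma
  assumes X: "dual_step TX i" and Y: "dual_step TY j"
    and D: "bounded_linear_map_on (level TX i) (level TY j) D"
  shows adjoint_map_pair:
      "\<lbrakk>y' \<in> carrier (level TY (Suc j)); x \<in> carrier (level TX i)\<rbrakk> \<Longrightarrow>
        pair TX i (adjoint_map TX i TY j D y') x = pair TY j y' (D x)"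
    and adjoint_map_bounded_linear:
      "bounded_linear_map_on (level TY (Suc j)) (level TX (Suc i)) (adjoint_map TX i TY j D)"
proof -
  interpret X: dual_step TX i by fact
  interpret Y: dual_step TY j by fact
  obtain K where K: "K \<ge> 0" "\<And>x. x \<in> carrier X.V \<Longrightarrow> nrm Y.V (D x) \<le> K * nrm X.V x"
    using normed_space.nonneg_bound[OF X.normed D] by blast
  have D_mem: "\<And>x. x \<in> carrier X.V \<Longrightarrow> D x \<in> carrier Y.V"
    and D_add: "\<And>x y. x \<in> carrier X.V \<Longrightarrow> y \<in> carrier X.V \<Longrightarrow> D (x \<oplus>\<^bsub>X.V\<^esub> y) = D x \<oplus>\<^bsub>Y.V\<^esub> D y"
    and D_smult: "\<And>c x. x \<in> carrier X.V \<Longrightarrow> D (c \<odot>\<^bsub>X.V\<^esub> x) = c \<odot>\<^bsub>Y.V\<^esub> D x"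
    using D by (auto simp: bounded_linear_map_on_def linear_map_on_def)
  have bound: "norm (pair TY j y' (D x)) \<le> K * nrm Y.V' y' * nrm X.V x"
    if "y' \<in> carrier Y.V'" "x \<in> carrier X.V" for y' x
  proof -
    have "norm (pair TY j y' (D x)) \<le> nrm Y.V' y' * nrm Y.V (D x)"
      using Y.norm_pair_le that D_mem by blast
    also have "\<dots> \<le> nrm Y.V' y' * (K * nrm X.V x)"
      by (intro mult_left_mono K normed_space.nrm_nonneg[OF Y.normed_dual] that)
    finally show ?thesis
      by (simp add: mult_ac)
  qed
  have bl: "bounded_linear_map_on X.V scalars (\<lambda>x. pair TY j y' (D x))" if "y' \<in> carrier Y.V'" for y'
    unfolding bounded_linear_map_on_scalars_iff
    using that bound by (auto simp: D_add D_smult D_mem Y.pair_add Y.pair_smult)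
  have mem: "adjoint_map TX i TY j D y' \<in> carrier X.V'" if "y' \<in> carrier Y.V'" for y'
    unfolding adjoint_map_def using X.functional_correct(1)[OF bl[OF that]] .
  have eq: "pair TX i (adjoint_map TX i TY j D y') x = pair TY j y' (D x)"
    if "y' \<in> carrier Y.V'" "x \<in> carrier X.V" for y' x
    unfolding adjoint_map_def using X.functional_correct(2)[OF bl[OF that(1)] that(2)] .
  then show "\<lbrakk>y' \<in> carrier (level TY (Suc j)); x \<in> carrier (level TX i)\<rbrakk> \<Longrightarrow>
        pair TX i (adjoint_map TX i TY j D y') x = pair TY j y' (D x)" .
  note closed = normed_space.add_closed[OF X.normed_dual] normed_space.scale_closed[OF X.normed_dual]
    normed_space.add_closed[OF Y.normed_dual] normed_space.scale_closed[OF Y.normed_dual]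
  show "bounded_linear_map_on (level TY (Suc j)) (level TX (Suc i)) (adjoint_map TX i TY j D)"
    unfolding bounded_linear_map_on_def linear_map_on_def
  proof (intro conjI ballI allI exI)
    show "adjoint_map TX i TY j D \<in> carrier Y.V' \<rightarrow> carrier X.V'"
      using mem by blast
  next
    fix x y assume "x \<in> carrier Y.V'" "y \<in> carrier Y.V'"
    then show "adjoint_map TX i TY j D (x \<oplus>\<^bsub>Y.V'\<^esub> y) =
        adjoint_map TX i TY j D x \<oplus>\<^bsub>X.V'\<^esub> adjoint_map TX i TY j D y"
      by (intro X.dual_eqI) (simp_all add: mem closed eq X.pair_add_left Y.pair_add_left D_mem)
  next
    fix c x assume "x \<in> carrier Y.V'"
    then show "adjoint_map TX i TY j D (c \<odot>\<^bsub>Y.V'\<^esub> x) = c \<odot>\<^bsub>X.V'\<^esub> adjoint_map TX i TY j D x"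
      by (intro X.dual_eqI) (simp_all add: mem closed eq X.pair_smult_left Y.pair_smult_left D_mem)
  next
    fix y' assume y': "y' \<in> carrier Y.V'"
    show "nrm X.V' (adjoint_map TX i TY j D y') \<le> K * nrm Y.V' y'"
      using y' K(1) normed_space.nrm_nonneg[OF Y.normed_dual y']
      by (intro X.nrm_dual_le) (simp_all add: mem eq bound)
  qed
qed

lemma
  assumes U: "normed_space U" and Y: "dual_step TY j" and Z: "dual_step TZ k"
    and m: "bounded_bilinear_map_on U (level TY j) (level TZ k) m"
  shows bilinear_adjoint_pair:
      "\<lbrakk>z' \<in> carrier (level TZ (Suc k)); u \<in> carrier U; y \<in> carrier (level TY j)\<rbrakk> \<Longrightarrow>
        pair TY j (bilinear_adjoint TY j TZ k m z' u) y = pair TZ k z' (m u y)"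
    and bilinear_adjoint_bounded:
      "bounded_bilinear_map_on (level TZ (Suc k)) U (level TY (Suc j)) (bilinear_adjoint TY j TZ k m)"
proof -
  interpret Y: dual_step TY j by fact
  interpret Z: dual_step TZ k by fact
  obtain K where K: "K \<ge> 0" "\<And>u y. u \<in> carrier U \<Longrightarrow> y \<in> carrier Y.V \<Longrightarrow>
      nrm Z.V (m u y) \<le> K * nrm U u * nrm Y.V y"
    using bilinear_nonneg_bound[OF m U Y.normed] by blast
  note nonneg = normed_space.nrm_nonneg[OF U] normed_space.nrm_nonneg[OF Z.normed_dual]
  have m_mem: "\<And>u y. u \<in> carrier U \<Longrightarrow> y \<in> carrier Y.V \<Longrightarrow> m u y \<in> carrier Z.V"
    and m_add: "\<And>u y y2. u \<in> carrier U \<Longrightarrow> y \<in> carrier Y.V \<Longrightarrow> y2 \<in> carrier Y.V \<Longrightarrow>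
        m u (y \<oplus>\<^bsub>Y.V\<^esub> y2) = m u y \<oplus>\<^bsub>Z.V\<^esub> m u y2"
    and m_smult: "\<And>c u y. u \<in> carrier U \<Longrightarrow> y \<in> carrier Y.V \<Longrightarrow>
        m u (c \<odot>\<^bsub>Y.V\<^esub> y) = c \<odot>\<^bsub>Z.V\<^esub> m u y"
    and m_add_left: "\<And>u u2 y. u \<in> carrier U \<Longrightarrow> u2 \<in> carrier U \<Longrightarrow> y \<in> carrier Y.V \<Longrightarrow>
        m (u \<oplus>\<^bsub>U\<^esub> u2) y = m u y \<oplus>\<^bsub>Z.V\<^esub> m u2 y"
    and m_smult_left: "\<And>c u y. u \<in> carrier U \<Longrightarrow> y \<in> carrier Y.V \<Longrightarrow>
        m (c \<odot>\<^bsub>U\<^esub> u) y = c \<odot>\<^bsub>Z.V\<^esub> m u y"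
    using m unfolding bounded_bilinear_map_on_iff by blast+
  have bound: "norm (pair TZ k z' (m u y)) \<le> K * nrm Z.V' z' * nrm U u * nrm Y.V y"
    if "z' \<in> carrier Z.V'" "u \<in> carrier U" "y \<in> carrier Y.V" for z' u y
  proof -
    have "norm (pair TZ k z' (m u y)) \<le> nrm Z.V' z' * nrm Z.V (m u y)"
      using Z.norm_pair_le that m_mem by blast
    also have "\<dots> \<le> nrm Z.V' z' * (K * nrm U u * nrm Y.V y)"
      by (intro mult_left_mono K nonneg that)
    finally show ?thesis
      by (simp add: mult_ac)
  qed
  let ?a = "bilinear_adjoint TY j TZ k m"
  have bl: "bounded_linear_map_on Y.V scalars (\<lambda>y. pair TZ k z' (m u y))"
    if "z' \<in> carrier Z.V'" "u \<in> carrier U" for z' u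
    unfolding bounded_linear_map_on_scalars_iff
    using that bound by (auto simp: m_add m_smult m_mem Z.pair_add Z.pair_smult)
  have mem: "?a z' u \<in> carrier Y.V'" if "z' \<in> carrier Z.V'" "u \<in> carrier U" for z' u
    unfolding bilinear_adjoint_def using Y.functional_correct(1)[OF bl[OF that]] .
  have eq: "pair TY j (?a z' u) y = pair TZ k z' (m u y)"
    if "z' \<in> carrier Z.V'" "u \<in> carrier U" "y \<in> carrier Y.V" for z' u y
    unfolding bilinear_adjoint_def using Y.functional_correct(2)[OF bl[OF that(1,2)] that(3)] .
  then show "\<lbrakk>z' \<in> carrier (level TZ (Suc k)); u \<in> carrier U; y \<in> carrier (level TY j)\<rbrakk> \<Longrightarrow>
        pair TY j (?a z' u) y = pair TZ k z' (m u y)" .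
  note closed = normed_space.add_closed[OF Y.normed_dual] normed_space.scale_closed[OF Y.normed_dual]
    normed_space.add_closed[OF Z.normed_dual] normed_space.scale_closed[OF Z.normed_dual]
    normed_space.add_closed[OF U] normed_space.scale_closed[OF U]
  show "bounded_bilinear_map_on (level TZ (Suc k)) U (level TY (Suc j)) ?a"
    unfolding bounded_bilinear_map_on_iff
  proof (intro conjI ballI allI exI)
    fix x y assume "x \<in> carrier Z.V'" "y \<in> carrier U"
    then show "?a x y \<in> carrier Y.V'" using mem by blast
  next
    fix x y y2 assume "x \<in> carrier Z.V'" "y \<in> carrier U" "y2 \<in> carrier U"
    then show "?a x (y \<oplus>\<^bsub>U\<^esub> y2) = ?a x y \<oplus>\<^bsub>Y.V'\<^esub> ?a x y2"
      by (intro Y.dual_eqI) (simp_all add: mem closed eq Y.pair_add_left Z.pair_add m_mem m_add_left)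
  next
    fix c x y assume "x \<in> carrier Z.V'" "y \<in> carrier U"
    then show "?a x (c \<odot>\<^bsub>U\<^esub> y) = c \<odot>\<^bsub>Y.V'\<^esub> ?a x y"
      by (intro Y.dual_eqI) (simp_all add: mem closed eq Y.pair_smult_left Z.pair_smult m_mem m_smult_left)
  next
    fix x x2 y assume "x \<in> carrier Z.V'" "x2 \<in> carrier Z.V'" "y \<in> carrier U"
    then show "?a (x \<oplus>\<^bsub>Z.V'\<^esub> x2) y = ?a x y \<oplus>\<^bsub>Y.V'\<^esub> ?a x2 y"
      by (intro Y.dual_eqI) (simp_all add: mem closed eq Y.pair_add_left Z.pair_add_left m_mem)
  next
    fix c x y assume "x \<in> carrier Z.V'" "y \<in> carrier U"
    then show "?a (c \<odot>\<^bsub>Z.V'\<^esub> x) y = c \<odot>\<^bsub>Y.V'\<^esub> ?a x y"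
      by (intro Y.dual_eqI) (simp_all add: mem closed eq Y.pair_smult_left Z.pair_smult_left m_mem)
  next
    fix x y assume xy: "x \<in> carrier Z.V'" "y \<in> carrier U"
    show "nrm Y.V' (?a x y) \<le> K * nrm Z.V' x * nrm U y"
      using xy K(1) nonneg by (intro Y.nrm_dual_le) (simp_all add: mem eq bound)
  qed
qed

text \<open>Reading \<open>\<langle>m\<^sup>*\<^sup>*\<^sup>*(x'', y''), z'\<rangle>\<close> from the inside out: \<open>y''\<close> is applied first, to the variable
  \<open>y\<close>, and \<open>x''\<close> last, to the variable \<open>x\<close>.  The intermediate element \<open>w = m\<^sup>*\<^sup>*(y'', z')\<close> records the
  functional to which \<open>x''\<close> is applied.\<close>

lemma
  assumes X: "dual_step TX i" "dual_step TX (Suc i)" and Y: "dual_step TY i" "dual_step TY (Suc i)"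
    and Z: "dual_step TZ i" "dual_step TZ (Suc i)"
    and m: "bounded_bilinear_map_on (level TX i) (level TY i) (level TZ i) m"
  shows arens_extension_bounded:
      "bounded_bilinear_map_on (level TX (Suc (Suc i))) (level TY (Suc (Suc i))) (level TZ (Suc (Suc i)))
        (arens_extension TX TY TZ i m)"
    and arens_extension_pair:
      "\<lbrakk>y'' \<in> carrier (level TY (Suc (Suc i))); z' \<in> carrier (level TZ (Suc i))\<rbrakk> \<Longrightarrow>
        \<exists>w\<in>carrier (level TX (Suc i)).
          (\<forall>x''\<in>carrier (level TX (Suc (Suc i))).
             pair TZ (Suc i) (arens_extension TX TY TZ i m x'' y'') z' = pair TX (Suc i) x'' w) \<and>
          (\<forall>x\<in>carrier (level TX i).
             pair TX i w x = pair TY (Suc i) y'' (bilinear_adjoint TY i TZ i m z' x))"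
proof -
  define m1 where "m1 = bilinear_adjoint TY i TZ i m"
  define m2 where "m2 = bilinear_adjoint TX i TY (Suc i) m1"
  have m3: "arens_extension TX TY TZ i m = bilinear_adjoint TZ (Suc i) TX (Suc i) m2"
    by (simp add: arens_extension_def Let_def m1_def m2_def)
  note n = dual_step.normed[OF X(1)] dual_step.normed[OF Z(2)] dual_step.normed_dual[OF Y(2)]
  have b1: "bounded_bilinear_map_on (level TZ (Suc i)) (level TX i) (level TY (Suc i)) m1"
    unfolding m1_def by (rule bilinear_adjoint_bounded[OF n(1) Y(1) Z(1) m])
  have b2: "bounded_bilinear_map_on (level TY (Suc (Suc i))) (level TZ (Suc i)) (level TX (Suc i)) m2"
    unfolding m2_def by (rule bilinear_adjoint_bounded[OF n(2) X(1) Y(2) b1])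
  show "bounded_bilinear_map_on (level TX (Suc (Suc i))) (level TY (Suc (Suc i))) (level TZ (Suc (Suc i)))
        (arens_extension TX TY TZ i m)"
    unfolding m3 by (rule bilinear_adjoint_bounded[OF n(3) Z(2) X(2) b2])
  assume y'': "y'' \<in> carrier (level TY (Suc (Suc i)))" and z': "z' \<in> carrier (level TZ (Suc i))"
  show "\<exists>w\<in>carrier (level TX (Suc i)).
          (\<forall>x''\<in>carrier (level TX (Suc (Suc i))).
             pair TZ (Suc i) (arens_extension TX TY TZ i m x'' y'') z' = pair TX (Suc i) x'' w) \<and>
          (\<forall>x\<in>carrier (level TX i).
             pair TX i w x = pair TY (Suc i) y'' (bilinear_adjoint TY i TZ i m z' x))"
  proof (intro bexI conjI ballI)
    show "m2 y'' z' \<in> carrier (level TX (Suc i))"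
      using b2 y'' z' by (simp add: bounded_bilinear_map_on_iff)
  next
    fix x'' assume "x'' \<in> carrier (level TX (Suc (Suc i)))"
    then show "pair TZ (Suc i) (arens_extension TX TY TZ i m x'' y'') z' = pair TX (Suc i) x'' (m2 y'' z')"
      unfolding m3 using bilinear_adjoint_pair[OF n(3) Z(2) X(2) b2] y'' z' by blast
  next
    fix x assume "x \<in> carrier (level TX i)"
    then show "pair TX i (m2 y'' z') x = pair TY (Suc i) y'' (bilinear_adjoint TY i TZ i m z' x)"
      unfolding m2_def m1_def[symmetric]
      using bilinear_adjoint_pair[OF n(2) X(1) Y(2) b1] y'' z' by blast
  qed
qed

text \<open>Boundedness has to be carried along the tower, as it ensures at each level that the
  descriptions defining the next extension denote.\<close>

lemma iterated_extension_bounded: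
  assumes "even n"
    and "\<And>i. i < n \<Longrightarrow> dual_step TX i" "\<And>i. i < n \<Longrightarrow> dual_step TY i" "\<And>i. i < n \<Longrightarrow> dual_step TZ i"
    and "bounded_bilinear_map_on (level TX 0) (level TY 0) (level TZ 0) m"
  shows "bounded_bilinear_map_on (level TX n) (level TY n) (level TZ n) (iterated_extension TX TY TZ m n)"
  using assms
proof (induction n rule: induct_nat_012)
  case (ge2 n)
  then have "bounded_bilinear_map_on (level TX n) (level TY n) (level TZ n) (iterated_extension TX TY TZ m n)"
    by simp
  with ge2.prems show ?case
    by (simp add: arens_extension_bounded)
qed auto


section \<open>The second adjoint of a derivation\<close>

text \<open>Both dual actions are first adjoints of actions, up to the order of the arguments; so
  \<open>bilinear_adjoint_pair\<close> and \<open>bilinear_adjoint_bounded\<close> apply to them.\<close>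

lemma dual_lact_eq: "dual_lact TA TB ract n a b' =
    bilinear_adjoint TB n TB n (\<lambda>a b. even_ract TA TB ract n b a) b' a"
  by (simp add: dual_lact_def bilinear_adjoint_def)

lemma dual_ract_eq: "dual_ract TA TB lact n = bilinear_adjoint TB n TB n (even_lact TA TB lact n)"
  by (intro ext) (simp add: dual_ract_def bilinear_adjoint_def)


theorem mainTheorem7:
  fixes A :: "('k::real_normed_field, 'v) normed_module"
    and B :: "('k, 'w) normed_module"
    and lact :: "'v \<Rightarrow> 'w \<Rightarrow> 'w" and ract :: "'w \<Rightarrow> 'v \<Rightarrow> 'w"
    and TA :: "('k, 'v) dual_tower" and TB :: "('k, 'w) dual_tower"
    and n :: nat and D :: "'v \<Rightarrow> 'w"
  assumes "banach_algebra A"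
    and "banach_bimodule A B lact ract"
    and "iterated_duals A (n + 2) TA"
    and "iterated_duals B (n + 3) TB"
    and "even n"
    and "derivation (level TA n) (even_mult TA n) (level TB (n + 1))
           (dual_lact TA TB ract n) (dual_ract TA TB lact n) D"
    and "left_weak_centre TA TB ract n = carrier (level TB (n + 2))"
  shows "derivation (level TA (n + 2)) (even_mult TA (n + 2)) (level TB (n + 3))
           (dual_lact TA TB ract (n + 2)) (dual_ract TA TB lact (n + 2))
           (second_adjoint TA n TB (n + 1) D)"
proof -
  define mu where "mu = even_mult TA n"
  define la where "la = even_lact TA TB lact n"
  define ra where "ra = even_ract TA TB ract n"
  define D2 where "D2 = second_adjoint TA n TB (n + 1) D"
  define D1 where "D1 = adjoint_map TA n TB (Suc n) D"
  let ?A = "level TA" and ?B = "level TB"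
  let ?n1 = "Suc n" and ?n2 = "Suc (Suc n)" and ?n3 = "Suc (Suc (Suc n))"

  interpret AB: banach_bimodule A B lact ract by fact
  have A_step: "dual_step TA i" if "i < n + 2" for i
    using dual_step_iterated[OF assms(3) AB.A.normed_space_axioms that] .
  have B_step: "dual_step TB i" if "i < n + 3" for i
    using dual_step_iterated[OF assms(4) AB.B.normed_space_axioms that] .
  interpret A0: dual_step TA n by (rule A_step) simp
  interpret A1: dual_step TA ?n1 by (rule A_step) simp
  interpret B0: dual_step TB n by (rule B_step) simp
  interpret B1: dual_step TB ?n1 by (rule B_step) simp
  interpret B2: dual_step TB ?n2 by (rule B_step) simp
  note A0 = A0.dual_step_axioms and A1 = A1.dual_step_axioms
  note B0 = B0.dual_step_axioms and B1 = B1.dual_step_axioms and B2 = B2.dual_step_axioms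

  have level_0: "?A 0 = A" "?B 0 = B"
    using assms(3,4) by (simp_all add: iterated_duals_def)
  have mu: "bounded_bilinear_map_on (?A n) (?A n) (?A n) mu"
    unfolding mu_def even_mult_def
    by (rule iterated_extension_bounded) (use assms(5) A_step AB.A.mult_bilinear level_0 in auto)
  have la: "bounded_bilinear_map_on (?A n) (?B n) (?B n) la"
    unfolding la_def even_lact_def
    by (rule iterated_extension_bounded) (use assms(5) A_step B_step AB.lact_bilinear level_0 in auto)
  have ra: "bounded_bilinear_map_on (?B n) (?A n) (?B n) ra"
    unfolding ra_def even_ract_def
    by (rule iterated_extension_bounded) (use assms(5) A_step B_step AB.ract_bilinear level_0 in auto)
  define mu2 where "mu2 = arens_extension TA TA TA n mu"
  define la2 where "la2 = arens_extension TA TB TB n la"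
  define ra2 where "ra2 = arens_extension TB TA TB n ra"
  have step2: "even_mult TA (n + 2) = mu2" "even_lact TA TB lact (n + 2) = la2"
      "even_ract TA TB ract (n + 2) = ra2"
    by (simp_all add: even_mult_def even_lact_def even_ract_def mu_def la_def ra_def
        mu2_def la2_def ra2_def)
  have mu2: "bounded_bilinear_map_on (?A ?n2) (?A ?n2) (?A ?n2) mu2"
    unfolding mu2_def by (rule arens_extension_bounded[OF A0 A1 A0 A1 A0 A1 mu])
  have la2: "bounded_bilinear_map_on (?A ?n2) (?B ?n2) (?B ?n2) la2"
    unfolding la2_def by (rule arens_extension_bounded[OF A0 A1 B0 B1 B0 B1 la])
  have ra2: "bounded_bilinear_map_on (?B ?n2) (?A ?n2) (?B ?n2) ra2"
    unfolding ra2_def by (rule arens_extension_bounded[OF B0 B1 A0 A1 B0 B1 ra])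
  note mu_mem = mu2[unfolded bounded_bilinear_map_on_iff, THEN conjunct1, rule_format]
  note la_mem = la2[unfolded bounded_bilinear_map_on_iff, THEN conjunct1, rule_format]
  note ra_mem = ra2[unfolded bounded_bilinear_map_on_iff, THEN conjunct1, rule_format]

  let ?lact1 = "dual_lact TA TB ract n" and ?ract1 = "dual_ract TA TB lact n"
  let ?lact3 = "dual_lact TA TB ract ?n2" and ?ract3 = "dual_ract TA TB lact ?n2"
  have lact1: "?lact1 a b' = bilinear_adjoint TB n TB n (\<lambda>a b. ra b a) b' a" for a b'
    by (simp add: dual_lact_eq ra_def)
  have ract1: "?ract1 = bilinear_adjoint TB n TB n la"
    by (simp add: dual_ract_eq la_def)
  have lact3: "?lact3 a b' = bilinear_adjoint TB ?n2 TB ?n2 (\<lambda>a b. ra2 b a) b' a" for a b'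
    by (simp add: dual_lact_eq step2[simplified])
  have ract3: "?ract3 = bilinear_adjoint TB ?n2 TB ?n2 la2"
    by (simp add: dual_ract_eq step2[simplified])

  have D: "bounded_linear_map_on (?A n) (?B ?n1) D"
    and Leibniz: "\<And>x y. x \<in> carrier (?A n) \<Longrightarrow> y \<in> carrier (?A n) \<Longrightarrow>
      D (mu x y) = ?lact1 x (D y) \<oplus>\<^bsub>?B ?n1\<^esub> ?ract1 (D x) y"
    using assms(6) by (simp_all add: derivation_def mu_def)
  have D_mem: "\<And>x. x \<in> carrier (?A n) \<Longrightarrow> D x \<in> carrier (?B ?n1)"
    using D by (auto simp: bounded_linear_map_on_def linear_map_on_def)
  have D1: "bounded_linear_map_on (?B ?n2) (?A ?n1) D1"
    unfolding D1_def by (rule adjoint_map_bounded_linear[OF A0 B1 D])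
  have D1_mem: "\<And>b. b \<in> carrier (?B ?n2) \<Longrightarrow> D1 b \<in> carrier (?A ?n1)"
    using D1 by (auto simp: bounded_linear_map_on_def linear_map_on_def)
  have D1_pair: "pair TA n (D1 b) x = pair TB ?n1 b (D x)"
    if "b \<in> carrier (?B ?n2)" "x \<in> carrier (?A n)" for b x
    unfolding D1_def by (rule adjoint_map_pair[OF A0 B1 D that])
  have D2_eq: "D2 = adjoint_map TB ?n2 TA ?n1 D1"
    by (simp add: D2_def second_adjoint_def D1_def)
  have D2: "bounded_linear_map_on (?A ?n2) (?B ?n3) D2"
    unfolding D2_eq by (rule adjoint_map_bounded_linear[OF B2 A1 D1])
  have D2_mem: "\<And>a. a \<in> carrier (?A ?n2) \<Longrightarrow> D2 a \<in> carrier (?B ?n3)"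
    using D2 by (auto simp: bounded_linear_map_on_def linear_map_on_def)
  have D2_pair: "pair TB ?n2 (D2 a) b = pair TA ?n1 a (D1 b)"
    if "a \<in> carrier (?A ?n2)" "b \<in> carrier (?B ?n2)" for a b
    unfolding D2_eq by (rule adjoint_map_pair[OF B2 A1 D1 that])

  have flip_ra: "bounded_bilinear_map_on (?A n) (?B n) (?B n) (\<lambda>a b. ra b a)"
    and flip_ra2: "bounded_bilinear_map_on (?A ?n2) (?B ?n2) (?B ?n2) (\<lambda>a b. ra2 b a)"
    using ra ra2 by (auto intro: bounded_bilinear_map_on_flip)
  have lact1_mem: "?lact1 x b' \<in> carrier (?B ?n1)"
    and ract1_mem: "?ract1 b' x \<in> carrier (?B ?n1)"
    if "x \<in> carrier (?A n)" "b' \<in> carrier (?B ?n1)" for x b'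
    using that bilinear_adjoint_bounded[OF A0.normed B0 B0 flip_ra]
      bilinear_adjoint_bounded[OF A0.normed B0 B0 la]
    by (simp_all add: lact1 ract1 bounded_bilinear_map_on_iff)
  have lact3_mem: "?lact3 a c \<in> carrier (?B ?n3)"
    and ract3_mem: "?ract3 c a \<in> carrier (?B ?n3)"
    if "a \<in> carrier (?A ?n2)" "c \<in> carrier (?B ?n3)" for a c
    using that bilinear_adjoint_bounded[OF A1.normed_dual B2 B2 flip_ra2]
      bilinear_adjoint_bounded[OF A1.normed_dual B2 B2 la2]
    by (simp_all add: lact3 ract3 bounded_bilinear_map_on_iff)
  have lact3_pair: "pair TB ?n2 (?lact3 a c) b = pair TB ?n2 c (ra2 b a)"
    and ract3_pair: "pair TB ?n2 (?ract3 c a) b = pair TB ?n2 c (la2 a b)"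
    if "a \<in> carrier (?A ?n2)" "c \<in> carrier (?B ?n3)" "b \<in> carrier (?B ?n2)" for a b c
    using that by (simp_all only: lact3 ract3 bilinear_adjoint_pair[OF A1.normed_dual B2 B2 flip_ra2]
        bilinear_adjoint_pair[OF A1.normed_dual B2 B2 la2])

  have "D2 (mu2 s t) = ?lact3 s (D2 t) \<oplus>\<^bsub>?B ?n3\<^esub> ?ract3 (D2 s) t"
    if s: "s \<in> carrier (?A ?n2)" and t: "t \<in> carrier (?A ?n2)" for s t
  proof (rule B2.dual_eqI)
    show "D2 (mu2 s t) \<in> carrier (?B ?n3)"
      using s t by (intro D2_mem mu_mem)
    show "?lact3 s (D2 t) \<oplus>\<^bsub>?B ?n3\<^esub> ?ract3 (D2 s) t \<in> carrier (?B ?n3)"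
      using s t by (intro normed_space.add_closed[OF B2.normed_dual] lact3_mem ract3_mem D2_mem)
    fix b assume b: "b \<in> carrier (?B ?n2)"
    \<comment> \<open>Each of \<open>\<langle>D''(s t), b\<rangle>\<close>, \<open>\<langle>s D''(t), b\<rangle>\<close> and \<open>\<langle>D''(s) t, b\<rangle>\<close> is \<open>s\<close> applied to a functional on
      \<open>A\<^sup>(\<^sup>n\<^sup>)\<close>, namely \<open>w\<close>, \<open>f\<close> and \<open>v\<close>; the Leibniz rule of \<open>D\<close> will give \<open>w = f + v\<close>.\<close>
    obtain w where w: "w \<in> carrier (?A ?n1)"
      and w_pair: "pair TA ?n1 (mu2 s t) (D1 b) = pair TA ?n1 s w"
      and w_apply: "\<And>x. x \<in> carrier (?A n) \<Longrightarrow>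
        pair TA n w x = pair TA ?n1 t (bilinear_adjoint TA n TA n mu (D1 b) x)"
      using arens_extension_pair[OF A0 A1 A0 A1 A0 A1 mu t D1_mem[OF b]] s unfolding mu2_def by blast
    define v where "v = D1 (la2 t b)"
    have v: "v \<in> carrier (?A ?n1)"
      unfolding v_def by (intro D1_mem la_mem t b)
    have v_apply: "\<exists>u\<in>carrier (?A ?n1). pair TA n v x = pair TA ?n1 t u \<and>
        (\<forall>y\<in>carrier (?A n). pair TA n u y = pair TB ?n1 b (?ract1 (D x) y))"
      if x: "x \<in> carrier (?A n)" for x
    proof -
      have "pair TA n v x = pair TB ?n1 (la2 t b) (D x)"
        unfolding v_def by (rule D1_pair[OF la_mem[OF t b] x])
      with arens_extension_pair[OF A0 A1 B0 B1 B0 B1 la b D_mem[OF x]] t show ?thesis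
        unfolding la2_def[symmetric] ract1 by metis
    qed

    define F where "F a = pair TB ?n2 (D2 t) (ra2 b a)" for a
    \<comment> \<open>This is \<open>\<langle>s D''(t), b\<rangle>\<close> as a function of \<open>s\<close>.\<close>
    have F_lin: "linear_map_on (?A ?n2) scalars F"
    proof -
      note * = ra2[unfolded bounded_bilinear_map_on_iff]
      show ?thesis
        unfolding linear_map_on_scalars_iff F_def
        using * b D2_mem[OF t] by (simp add: B2.pair_add B2.pair_smult)
    qed
    have "openin (weak_star_top TA ?n1) {a \<in> carrier (?A ?n2). norm (F a) < 1}"
    proof -
      let ?S = "{c \<in> carrier (?B ?n2). pair TB ?n2 (D2 t) c \<in> ball 0 1}"
      have "continuous_map (weak_star_top TA ?n1) (weak_top TB ?n2) (\<lambda>a. ra2 b a)"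
      proof -
        have "b \<in> left_weak_centre TA TB ract n"
          unfolding assms(7) using b by simp
        then show ?thesis
          unfolding left_weak_centre_def step2 by simp
      qed
      moreover have "openin (weak_top TB ?n2) ?S"
        unfolding weak_top_def initial_topology_def
      proof (rule topology_generated_by_Basis, rule insertI2, rule CollectI, intro exI conjI)
        show "(\<lambda>c. pair TB ?n2 (D2 t) c) \<in> (\<lambda>x' x. pair TB ?n2 x' x) ` carrier (?B ?n3)"
          using D2_mem[OF t] by (rule imageI)
        show "open (ball (0::'k) 1)"
          by simp
        show "?S = ?S" ..
      qed
      moreover have "topspace (weak_star_top TA ?n1) = carrier (?A ?n2)"
        by (auto simp: weak_star_top_def initial_topology_def)
      ultimately have "openin (weak_star_top TA ?n1) {a \<in> carrier (?A ?n2). ra2 b a \<in> ?S}"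
        using openin_continuous_map_preimage by fastforce
      moreover have "{a \<in> carrier (?A ?n2). ra2 b a \<in> ?S} = {a \<in> carrier (?A ?n2). norm (F a) < 1}"
        using ra_mem[OF b] by (auto simp: F_def)
      ultimately show ?thesis by simp
    qed
    then obtain f where f: "f \<in> carrier (?A ?n1)" and f_eval: "\<And>a. a \<in> carrier (?A ?n2) \<Longrightarrow> F a = pair TA ?n1 a f"
      using A1.weak_star_continuous_is_eval[OF F_lin] by blast

    have f_apply: "\<exists>p\<in>carrier (?A ?n1). pair TA n f x = pair TA ?n1 t p \<and>
        (\<forall>y\<in>carrier (?A n). pair TA n p y = pair TB ?n1 b (?lact1 x (D y)))"
      if x: "x \<in> carrier (?A n)" for x
    proof -
      \<comment> \<open>\<open>x\<close> as a point of \<open>A\<^sup>(\<^sup>n\<^sup>+\<^sup>2\<^sup>)\<close>\<close>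
      define j where "j = functional TA ?n1 (\<lambda>x'. pair TA n x' x)"
      have j: "j \<in> carrier (?A ?n2)"
        and j_pair: "\<And>x'. x' \<in> carrier (?A ?n1) \<Longrightarrow> pair TA ?n1 j x' = pair TA n x' x"
        unfolding j_def using A1.functional_correct[OF A0.eval_bounded_linear[OF x]] by auto
      have bj: "ra2 b j \<in> carrier (?B ?n2)"
        by (rule ra_mem[OF b j])
      \<comment> \<open>\<open>b x\<close> is computed inside \<open>B\<^sup>(\<^sup>n\<^sup>+\<^sup>2\<^sup>)\<close> by the dual action of \<open>x\<close> on \<open>B\<^sup>(\<^sup>n\<^sup>+\<^sup>1\<^sup>)\<close>.\<close>
      have bj_pair: "pair TB ?n1 (ra2 b j) c = pair TB ?n1 b (?lact1 x c)" if c: "c \<in> carrier (?B ?n1)" for c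
      proof -
        obtain u where u: "u \<in> carrier (?B ?n1)"
          and u_pair: "pair TB ?n1 (ra2 b j) c = pair TB ?n1 b u"
          and u_apply: "\<And>y. y \<in> carrier (?B n) \<Longrightarrow>
            pair TB n u y = pair TA ?n1 j (bilinear_adjoint TA n TB n ra c y)"
          using arens_extension_pair[OF B0 B1 A0 A1 B0 B1 ra j c] b unfolding ra2_def by blast
        note adj = bilinear_adjoint_bounded[OF B0.normed A0 B0 ra]
        have "u = ?lact1 x c"
        proof (rule B0.dual_eqI[OF u lact1_mem[OF x c]])
          fix y assume y: "y \<in> carrier (?B n)"
          have "bilinear_adjoint TA n TB n ra c y \<in> carrier (?A ?n1)"
            using adj c y by (simp add: bounded_bilinear_map_on_iff)
          then have "pair TB n u y = pair TB n c (ra y x)"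
            using u_apply[OF y] j_pair bilinear_adjoint_pair[OF B0.normed A0 B0 ra c y x] by simp
          then show "pair TB n u y = pair TB n (?lact1 x c) y"
            unfolding lact1 bilinear_adjoint_pair[OF A0.normed B0 B0 flip_ra c x y] .
        qed
        with u_pair show ?thesis by simp
      qed
      have "pair TA n f x = F j"
        using f_eval[OF j] j_pair[OF f] by simp
      also have "F j = pair TA ?n1 t (D1 (ra2 b j))"
        unfolding F_def by (rule D2_pair[OF t bj])
      finally show ?thesis
        using D1_mem[OF bj] by (intro bexI[of _ "D1 (ra2 b j)"]) (simp_all add: D1_pair[OF bj] bj_pair D_mem)
    qed

    have "w = f \<oplus>\<^bsub>?A ?n1\<^esub> v"
    proof (rule A0.dual_eqI[OF w normed_space.add_closed[OF A0.normed_dual f v]])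
      fix x assume x: "x \<in> carrier (?A n)"
      show "pair TA n w x = pair TA n (f \<oplus>\<^bsub>?A ?n1\<^esub> v) x"
      proof -
        obtain p where p: "p \<in> carrier (?A ?n1)" "pair TA n f x = pair TA ?n1 t p"
          "\<And>y. y \<in> carrier (?A n) \<Longrightarrow> pair TA n p y = pair TB ?n1 b (?lact1 x (D y))"
          using f_apply[OF x] by blast
        obtain u where u: "u \<in> carrier (?A ?n1)" "pair TA n v x = pair TA ?n1 t u"
          "\<And>y. y \<in> carrier (?A n) \<Longrightarrow> pair TA n u y = pair TB ?n1 b (?ract1 (D x) y)"
          using v_apply[OF x] by blast
        let ?d = "bilinear_adjoint TA n TA n mu (D1 b) x"
        have d: "?d \<in> carrier (?A ?n1)"
          using bilinear_adjoint_bounded[OF A0.normed A0 A0 mu] D1_mem[OF b] x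
          by (simp add: bounded_bilinear_map_on_iff)
        have "?d = p \<oplus>\<^bsub>?A ?n1\<^esub> u"
        proof (rule A0.dual_eqI[OF d normed_space.add_closed[OF A0.normed_dual p(1) u(1)]])
          fix y assume y: "y \<in> carrier (?A n)"
          have "mu x y \<in> carrier (?A n)"
            using mu x y by (simp add: bounded_bilinear_map_on_iff)
          then have "pair TA n ?d y = pair TB ?n1 b (D (mu x y))"
            using bilinear_adjoint_pair[OF A0.normed A0 A0 mu D1_mem[OF b] x y] D1_pair[OF b] by simp
          also have "\<dots> = pair TB ?n1 b (?lact1 x (D y)) + pair TB ?n1 b (?ract1 (D x) y)"
            unfolding Leibniz[OF x y]
            by (rule B1.pair_add[OF b lact1_mem[OF x D_mem[OF y]] ract1_mem[OF y D_mem[OF x]]])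
          also have "\<dots> = pair TA n (p \<oplus>\<^bsub>?A ?n1\<^esub> u) y"
            using p(3)[OF y] u(3)[OF y] A0.pair_add_left[OF p(1) u(1) y] by simp
          finally show "pair TA n ?d y = pair TA n (p \<oplus>\<^bsub>?A ?n1\<^esub> u) y" .
        qed
        then have "pair TA n w x = pair TA ?n1 t p + pair TA ?n1 t u"
          using w_apply[OF x] A1.pair_add[OF t p(1) u(1)] by simp
        then show ?thesis
          using p(2) u(2) A0.pair_add_left[OF f v x] by simp
      qed
    qed
    then have "pair TB ?n2 (D2 (mu2 s t)) b = pair TA ?n1 s f + pair TA ?n1 s v"
      using D2_pair[OF mu_mem[OF s t] b] w_pair A1.pair_add[OF s f v] by simp
    also have "pair TA ?n1 s f = pair TB ?n2 (?lact3 s (D2 t)) b"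
      using f_eval[OF s] lact3_pair[OF s D2_mem[OF t] b] by (simp add: F_def)
    also have "pair TA ?n1 s v = pair TB ?n2 (?ract3 (D2 s) t) b"
      unfolding ract3_pair[OF t D2_mem[OF s] b] v_def by (rule D2_pair[OF s la_mem[OF t b], symmetric])
    finally show "pair TB ?n2 (D2 (mu2 s t)) b =
        pair TB ?n2 (?lact3 s (D2 t) \<oplus>\<^bsub>?B ?n3\<^esub> ?ract3 (D2 s) t) b"
      using B2.pair_add_left[OF lact3_mem[OF s D2_mem[OF t]] ract3_mem[OF t D2_mem[OF s]] b] by simp
  qed
  with D2 show ?thesis
    by (simp add: derivation_def D2_def step2[simplified] numeral_3_eq_3)
qed

end
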